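(* Consider a multi-agent system whose workflow has $n$ steps, where each step has $\alpha$ possible tools or prompt options and $\alpha$ is a constant (not depending on the step or on $n$). Define the efficiency $\eta = \mathcal{S}_{\mathrm{std}}/\mathcal{S}_{\mathrm{rollback}}$ as the ratio of the total number of steps required by a system without a rollback mechanism to the total number of steps required by a system with a rollback mechanism, in each case to generate all possible final results. Then, as $n\to\infty$, the growth of the efficiency is infinite: $$\lim_{n\to\infty} \eta = \infty .$$
   Context: A workflow with $n$ steps and $x_i$ options (tools or prompts) at step $i$ is modelled by a rooted tree: the root is the initial input; each node at depth $i-1$ has exactly $x_i$ children at depth $i$, one for each option at step $i$, for $1 \le i \le n$. Leaves (nodes at depth $n$) are the possible final results, and each edge represents one execution of one step. Here $x_i = \alpha$ for all $i$. $\mathcal{S}_{\mathrm{std}}$ is the total number of step executions needed to generate all final results without rollback: for each leaf separately, the full root-to-leaf path of $n$ steps is executed, and the lengths of all these paths are added up. $\mathcal{S}_{\mathrm{rollback}}$ is the total number of step executions needed with rollback: intermediate nodes are stored as checkpoints from which execution may be resumed, so previous steps are not re-executed, and $\mathcal{S}_{\mathrm{rollback}}$ is the number of edges of the tree.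
   Formalization: The formal statement assumes that each step has at least two options (α ≥ 2); for α = 1 both step totals equal n, so the efficiency is constantly 1 and the claim fails, and for α = 0 the efficiency is 0/0. *)

theory Defs
  imports Complex_Main
begin

text \<open>
  A workflow has \<open>n\<close> steps, with \<open>x i\<close> options at step \<open>i\<close> for \<open>1 \<le> i \<le> n\<close>. A node of its tree at
  depth \<open>d\<close> is the list of the options chosen at steps \<open>1, \<dots>, d\<close>; the options at step \<open>i\<close> are
  numbered \<open>0, \<dots>, x i - 1\<close>. List positions count from 0, so position \<open>j\<close> holds the choice made at
  step \<open>Suc j\<close>. The root is \<open>[]\<close>.
\<close>

definition nodes :: "nat \<Rightarrow> (nat \<Rightarrow> nat) \<Rightarrow> nat list set" where
  "nodes n x = {v. length v \<le> n \<and> (\<forall>j<length v. v ! j < x (Suc j))}"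

definition edges :: "nat \<Rightarrow> (nat \<Rightarrow> nat) \<Rightarrow> (nat list \<times> nat list) set" where
  "edges n x = {(u, v). u \<in> nodes n x \<and> v \<in> nodes n x \<and> (\<exists>c. v = u @ [c])}"

definition leaves :: "nat \<Rightarrow> (nat \<Rightarrow> nat) \<Rightarrow> nat list set" where
  "leaves n x = {v \<in> nodes n x. length v = n}"

text \<open>The path from the root to \<open>v\<close>, as the list of its edges (see \<open>walk_from_root_iff\<close>).\<close>

definition root_path :: "nat list \<Rightarrow> (nat list \<times> nat list) list" where
  "root_path v = map (\<lambda>j. (take j v, take (Suc j) v)) [0..<length v]"

definition S_std :: "nat \<Rightarrow> (nat \<Rightarrow> nat) \<Rightarrow> nat" where
  "S_std n x = (\<Sum>v\<in>leaves n x. length (root_path v))"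

definition S_rollback :: "nat \<Rightarrow> (nat \<Rightarrow> nat) \<Rightarrow> nat" where
  "S_rollback n x = card (edges n x)"

definition efficiency :: "nat \<Rightarrow> (nat \<Rightarrow> nat) \<Rightarrow> real" where
  "efficiency n x = real (S_std n x) / real (S_rollback n x)"

text \<open>
  Sanity checks: the sets above are finite (so the sum and the cardinality mean what they should),
  a node at depth \<open>i < n\<close> has exactly \<open>x (Suc i)\<close> children, and \<open>root_path v\<close> is the unique walk
  from the root to \<open>v\<close>.
\<close>

lemma finite_nodes: "finite (nodes n x)"
proof -
  have "nodes n x \<subseteq> {v. set v \<subseteq> (\<Union>i\<in>{..n}. {..<x i}) \<and> length v \<le> n}"
    unfolding nodes_def by (fastforce simp: in_set_conv_nth)
  then show ?thesis
    by (rule finite_subset) (rule finite_lists_length_le, simp)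
qed

lemma finite_edges: "finite (edges n x)"
  by (rule finite_subset[of _ "nodes n x \<times> nodes n x"]) (auto simp: edges_def finite_nodes)

lemma finite_leaves: "finite (leaves n x)"
  by (simp add: leaves_def finite_nodes)

lemma snoc_in_nodes_iff:
  "v @ [c] \<in> nodes n x \<longleftrightarrow> v \<in> nodes n x \<and> length v < n \<and> c < x (Suc (length v))"
  by (auto simp: nodes_def nth_append less_Suc_eq)

lemma card_children:
  assumes "u \<in> nodes n x" "length u < n"
  shows "card {v. (u, v) \<in> edges n x} = x (Suc (length u))"
proof -
  have "{v. (u, v) \<in> edges n x} = (\<lambda>c. u @ [c]) ` {..<x (Suc (length u))}"
    using assms by (auto simp: edges_def snoc_in_nodes_iff)
  then show ?thesis
    by (simp add: card_image inj_on_def)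
qed

inductive walk_from_root :: "nat \<Rightarrow> (nat \<Rightarrow> nat) \<Rightarrow> (nat list \<times> nat list) list \<Rightarrow> nat list \<Rightarrow> bool"
  for n x where
  "walk_from_root n x [] []"
| "walk_from_root n x p u \<Longrightarrow> (u, v) \<in> edges n x \<Longrightarrow> walk_from_root n x (p @ [(u, v)]) v"

lemma root_path_snoc: "root_path (v @ [c]) = root_path v @ [(v, v @ [c])]"
  by (simp add: root_path_def)

lemma walk_from_root_iff:
  assumes "v \<in> nodes n x"
  shows "walk_from_root n x p v \<longleftrightarrow> p = root_path v"
proof
  assume "walk_from_root n x p v"
  then show "p = root_path v"
  proof induction
    case 1
    show ?case by (simp add: root_path_def)
  next
    case (2 p u v)
    then show ?case by (auto simp: edges_def root_path_snoc)
  qed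
next
  have "walk_from_root n x (root_path v) v"
    using assms
  proof (induction v rule: rev_induct)
    case Nil
    then show ?case by (simp add: root_path_def walk_from_root.intros)
  next
    case (snoc c v)
    then show ?case
      by (auto simp: root_path_snoc snoc_in_nodes_iff edges_def intro!: walk_from_root.intros)
  qed
  then show "p = root_path v \<Longrightarrow> walk_from_root n x p v" by simp
qed

end

theory Submission
  imports Defs
begin

text \<open>
  There are \<open>\<alpha> ^ n\<close> leaves, each at the end of a path of length \<open>n\<close>, so
  \<open>S_std = n * \<alpha> ^ n\<close>. Every edge is determined by its lower end, so
  \<open>S_rollback = \<alpha> + \<dots> + \<alpha> ^ n\<close>. For \<open>\<alpha> \<ge> 2\<close> the last level of this geometric sum dominates:
  the sum is at most \<open>2 * \<alpha> ^ n\<close>, whence the efficiency is at least \<open>n / 2\<close>.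
\<close>

text \<open>Turns the positionwise bound into a bound on the set of entries, so that the standard
  counts of lists over a finite alphabet apply.\<close>

lemma nodes_const: "nodes n (\<lambda>i. a) = {v. set v \<subseteq> {..<a} \<and> length v \<le> n}"
  by (auto simp: nodes_def set_conv_nth)

lemma card_leaves_const: "card (leaves n (\<lambda>i. a)) = a ^ n"
proof -
  have "leaves n (\<lambda>i. a) = {v. set v \<subseteq> {..<a} \<and> length v = n}"
    by (auto simp: leaves_def nodes_const)
  then show ?thesis
    by (simp add: card_lists_length_eq)
qed

lemma S_std_eq: "S_std n x = n * card (leaves n x)"
proof -
  have "S_std n x = (\<Sum>v\<in>leaves n x. n)"
    unfolding S_std_def by (rule sum.cong) (auto simp: root_path_def leaves_def)
  then show ?thesis
    by simp
qed

lemma S_rollback_eq: "S_rollback n x = card (nodes n x - {[]})"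
proof -
  have "inj_on snd (edges n x)"
    by (auto simp: inj_on_def edges_def)
  moreover have "snd ` edges n x = nodes n x - {[]}"
  proof (intro equalityI subsetI)
    fix v assume "v \<in> nodes n x - {[]}"
    then obtain u c where "v = u @ [c]" "v \<in> nodes n x"
      by (cases v rule: rev_cases) auto
    then have "(u, v) \<in> edges n x"
      by (simp add: edges_def snoc_in_nodes_iff)
    then show "v \<in> snd ` edges n x"
      by force
  qed (auto simp: edges_def)
  ultimately show ?thesis
    unfolding S_rollback_def by (metis card_image)
qed

lemma S_rollback_const: "S_rollback n (\<lambda>i. a) = (\<Sum>i=1..n. a ^ i)"
proof -
  have "card (nodes n (\<lambda>i. a)) = (\<Sum>i\<le>n. a ^ i)"
    by (simp add: nodes_const card_lists_length_le)
  \<comment> \<open>The term \<open>a ^ 0 = 1\<close> split off counts the root, the lower end of no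
    edge.\<close>
  also have "\<dots> = Suc (\<Sum>i=1..n. a ^ i)"
    by (simp add: atMost_atLeast0 sum.atLeast_Suc_atMost)
  finally show ?thesis
    by (simp add: S_rollback_eq card_Diff_singleton nodes_const)
qed

lemma sum_powers_le:
  fixes a :: nat
  assumes "a \<ge> 2"
  shows "(\<Sum>i=1..n. a ^ i) \<le> 2 * a ^ n"
proof (induction n)
  case (Suc n)
  \<comment> \<open>So all earlier levels together fit into one further copy of the new term
    \<open>a ^ Suc n\<close>.\<close>
  also have "2 * a ^ n \<le> a ^ Suc n"
    using assms by simp
  finally show ?case
    by simp
qed simp

lemma efficiency_ge:
  assumes "a \<ge> 2"
  shows "real n / 2 \<le> efficiency n (\<lambda>i. a)"
proof (cases "n = 0")
  case False
  \<comment> \<open>The summand \<open>i = n\<close> makes the denominator positive, so the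
    inequality can be divided by it.\<close>
  have "a ^ n \<le> (\<Sum>i=1..n. a ^ i)"
    using False by (intro member_le_sum) auto
  then have pos: "0 < S_rollback n (\<lambda>i. a)"
    using assms unfolding S_rollback_const by (simp add: less_le_trans[of 0 "a ^ n"])
  have "n * S_rollback n (\<lambda>i. a) \<le> 2 * S_std n (\<lambda>i. a)"
    using mult_left_mono[OF sum_powers_le[OF assms], of n n]
    by (simp add: S_rollback_const S_std_eq card_leaves_const mult_ac)
  then have "real n * real (S_rollback n (\<lambda>i. a)) \<le> 2 * real (S_std n (\<lambda>i. a))"
    by (metis of_nat_mono of_nat_mult of_nat_numeral)
  then show ?thesis
    using pos by (simp add: efficiency_def field_simps)
qed (simp add: efficiency_def)

text \<open>For \<alpha> = 1 the tree is a single path and the efficiency is 1 for all n > 0, hence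
  the bound on \<alpha>.\<close>

theorem proposition1:
  fixes \<alpha> :: nat
  assumes "\<alpha> \<ge> 2"
  shows "filterlim (\<lambda>n. efficiency n (\<lambda>i. \<alpha>)) at_top sequentially"
proof (rule filterlim_at_top_mono)
  have "filterlim (\<lambda>n. (1 / 2) * real n) at_top sequentially"
    by (rule filterlim_tendsto_pos_mult_at_top[OF tendsto_const _ filterlim_real_sequentially]) simp
  then show "filterlim (\<lambda>n. real n / 2) at_top sequentially"
    by simp
  show "\<forall>\<^sub>F n in sequentially. real n / 2 \<le> efficiency n (\<lambda>i. \<alpha>)"
    using efficiency_ge[OF assms] by simp
qed

end
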